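(* Let $G$ be a connected undirected graph on $n\ge 2$ vertices with no loops but possibly multiple edges, let $|E(G)|$ be its number of edges, and let $\mathbf r$ be an arithmetical structure on $G$, with vertices ordered so that $r_1\ge r_2\ge\cdots\ge r_n$. Then \[r_1 \leq \frac{1}{(n-1)!}\, |E(G)|^{3\cdot 2^{n-2}-2}.\]
   Context: With vertices $v_1,\dots,v_n$ and $\delta_{ij}$ edges between $v_i$ and $v_j$, an arithmetical structure on $G$ is a pair $(\mathbf r,\mathbf d)$ of vectors of positive integers with $\gcd(r_1,\dots,r_n)=1$ and $r_id_i=\sum_{j\neq i}r_j\delta_{ij}$ for all $i$; it is identified with $\mathbf r$. *)

theory Defs
  imports Complex_Main
begin

record ('v, 'e) multigraph =
  verts :: "'v set"
  edges :: "'e set"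
  ends :: "'e \<Rightarrow> 'v set"

definition loopless_multigraph :: "('v, 'e) multigraph \<Rightarrow> bool" where
  "loopless_multigraph G \<longleftrightarrow>
     finite (verts G) \<and> finite (edges G) \<and>
     (\<forall>e\<in>edges G. ends G e \<subseteq> verts G \<and> card (ends G e) = 2)"

definition edge_mult :: "('v, 'e) multigraph \<Rightarrow> 'v \<Rightarrow> 'v \<Rightarrow> nat" where
  "edge_mult G x y = card {e \<in> edges G. ends G e = {x, y}}"

definition adjacency :: "('v, 'e) multigraph \<Rightarrow> ('v \<times> 'v) set" where
  "adjacency G = {(x, y). \<exists>e\<in>edges G. ends G e = {x, y}}"

definition connected_multigraph :: "('v, 'e) multigraph \<Rightarrow> bool" where
  "connected_multigraph G \<longleftrightarrow>
     verts G \<noteq> {} \<and> (\<forall>x\<in>verts G. \<forall>y\<in>verts G. (x, y) \<in> (adjacency G)\<^sup>*)"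

text \<open>The vectors \<open>r\<close> and \<open>d\<close> are indexed by the vertices themselves; values
  outside \<open>verts G\<close> are irrelevant.\<close>

definition arithmetical_structure ::
  "('v, 'e) multigraph \<Rightarrow> ('v \<Rightarrow> nat) \<Rightarrow> ('v \<Rightarrow> nat) \<Rightarrow> bool" where
  "arithmetical_structure G r d \<longleftrightarrow>
     (\<forall>x\<in>verts G. r x > 0 \<and> d x > 0) \<and>
     Gcd (r ` verts G) = 1 \<and>
     (\<forall>x\<in>verts G. r x * d x = (\<Sum>y\<in>verts G - {x}. r y * edge_mult G x y))"

end

theory Submission
  imports Defs
begin

text \<open>
  Eliminate a vertex \<open>x\<close> where \<open>r\<close> is largest: with \<open>d\<close> the multiplicity of the structure at \<open>x\<close>,
  put \<open>d * w j k + w j x * w x k\<close> edges between \<open>j\<close> and \<open>k\<close>. The restriction of \<open>r\<close>, divided by its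
  greatest common divisor \<open>g\<close>, is an arithmetical structure on the resulting connected graph.
  Maximality of \<open>r x\<close> gives \<open>d \<le> deg x\<close>, so a graph with \<open>E\<close> edges becomes one with at most
  \<open>E\<^sup>2 / 2\<close> edges. Since \<open>g\<close> is coprime to \<open>r x\<close>, it divides \<open>d\<close>; hence \<open>r x\<close> is at most
  \<open>deg x\<close> times the largest entry of the new structure, and induction on the number of vertices
  applies.
\<close>

section \<open>Weighted graphs and the elimination of a vertex\<close>

text \<open>Multigraphs are represented by symmetric weights with zero diagonal. Connectedness is stated
  through cuts because this form passes easily to the graph with a vertex eliminated.\<close>

definition connected_weights :: "'v set \<Rightarrow> ('v \<Rightarrow> 'v \<Rightarrow> nat) \<Rightarrow> bool" where
  "connected_weights V w \<longleftrightarrow>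
     (\<forall>S. S \<subseteq> V \<longrightarrow> S \<noteq> {} \<longrightarrow> S \<noteq> V \<longrightarrow> (\<exists>a\<in>S. \<exists>b\<in>V - S. w a b > 0))"

text \<open>Off the diagonal this is a Schur complement: take the matrix with \<open>- w j k\<close>
  off the diagonal and pivot \<open>d\<close> at \<open>x\<close>, eliminate \<open>x\<close>, and
  multiply by \<open>- d\<close>. The diagonal is reset to 0 because the products
  \<open>w j x * w x j\<close> would create loops.\<close>

definition eliminate :: "('v \<Rightarrow> 'v \<Rightarrow> nat) \<Rightarrow> 'v \<Rightarrow> nat \<Rightarrow> 'v \<Rightarrow> 'v \<Rightarrow> nat" where
  "eliminate w x d j k = (if j = k then 0 else d * w j k + w j x * w x k)"

text \<open>An old edge across the cut survives because \<open>d > 0\<close>. If there is none,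
  connectedness forces both sides to be joined to \<open>x\<close>, and the path through
  \<open>x\<close> becomes an edge.\<close>

lemma connected_weights_eliminate:
  assumes "connected_weights V w" "x \<in> V" "d > 0" and sym: "\<And>a b. w a b = w b a"
  shows "connected_weights (V - {x}) (eliminate w x d)"
  unfolding connected_weights_def
proof (intro allI impI)
  fix S assume S: "S \<subseteq> V - {x}" "S \<noteq> {}" "S \<noteq> V - {x}"
  let ?T = "V - {x} - S"
  have cut: "\<exists>a\<in>S. \<exists>b\<in>V - S. w a b > 0" if "S \<subseteq> V" "S \<noteq> {}" "S \<noteq> V" for S
    using assms(1) that unfolding connected_weights_def by blast
  show "\<exists>a\<in>S. \<exists>b\<in>?T. eliminate w x d a b > 0"
  proof (cases "\<exists>a\<in>S. \<exists>b\<in>?T. w a b > 0")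
    case True
    then obtain a b where "a \<in> S" "b \<in> ?T" "w a b > 0" by blast
    then have "eliminate w x d a b > 0"
      using \<open>d > 0\<close> by (auto simp: eliminate_def)
    with \<open>a \<in> S\<close> \<open>b \<in> ?T\<close> show ?thesis by blast
  next
    case False
    have "\<exists>a\<in>S. \<exists>b\<in>V - S. w a b > 0"
      using S \<open>x \<in> V\<close> by (intro cut) auto
    with False obtain a where a: "a \<in> S" "w a x > 0" by blast
    have "\<exists>a\<in>?T. \<exists>b\<in>V - ?T. w a b > 0"
      using S \<open>x \<in> V\<close> by (intro cut) auto
    with False sym obtain b where b: "b \<in> ?T" "w b x > 0"
      by (metis Diff_iff insertE emptyE insertI1)
    have "eliminate w x d a b > 0"
      using a b sym[of b x] by (auto simp: eliminate_def)
    with a b show ?thesis by blast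
  qed
qed

text \<open>With the diagonal term restored, the relation at \<open>x\<close> turns the sum into
  \<open>d\<close> times the old sum at \<open>j\<close>, which \<open>r j\<close> divides. The
  restored term is itself a multiple of \<open>r j\<close>.\<close>

lemma dvd_sum_eliminate:
  fixes r :: "'v \<Rightarrow> nat"
  assumes "finite V" "x \<in> V" "j \<in> V - {x}" "\<And>a. w a a = 0"
    and "r j dvd (\<Sum>k\<in>V. r k * w j k)"
    and rx: "r x * d = (\<Sum>k\<in>V. r k * w x k)"
  shows "r j dvd (\<Sum>k\<in>V - {x}. r k * eliminate w x d j k)"
proof -
  let ?V = "V - {x}"
  have fin: "finite ?V" using assms by simp
  have "(\<Sum>k\<in>?V. r k * eliminate w x d j k) + r j * (w j x * w x j)
      = (\<Sum>k\<in>?V. r k * (d * w j k + w j x * w x k))"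
  proof -
    have "(\<Sum>k\<in>?V - {j}. r k * eliminate w x d j k)
        = (\<Sum>k\<in>?V - {j}. r k * (d * w j k + w j x * w x k))"
      by (intro sum.cong) (auto simp: eliminate_def)
    moreover have "eliminate w x d j j = 0" by (simp add: eliminate_def)
    ultimately show ?thesis
      using assms(4) by (simp add: sum.remove[OF fin assms(3)])
  qed
  also have "\<dots> = d * (\<Sum>k\<in>?V. r k * w j k) + w j x * (\<Sum>k\<in>?V. r k * w x k)"
    by (simp add: sum.distrib sum_distrib_left algebra_simps)
  also have "(\<Sum>k\<in>?V. r k * w x k) = r x * d"
    using assms(4) by (simp add: rx sum.remove[OF \<open>finite V\<close> \<open>x \<in> V\<close>])
  also have "d * (\<Sum>k\<in>?V. r k * w j k) + w j x * (r x * d) = d * (\<Sum>k\<in>V. r k * w j k)"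
    by (simp add: sum.remove[OF \<open>finite V\<close> \<open>x \<in> V\<close>] algebra_simps)
  finally have "r j dvd (\<Sum>k\<in>?V. r k * eliminate w x d j k) + r j * (w j x * w x j)"
    using assms(5) by simp
  then show ?thesis by (simp add: dvd_add_left_iff)
qed

lemma total_weight_remove:
  fixes w :: "'v \<Rightarrow> 'v \<Rightarrow> nat"
  assumes "finite V" "x \<in> V" "\<And>a b. w a b = w b a" "w x x = 0"
  shows "(\<Sum>a\<in>V. \<Sum>b\<in>V. w a b)
    = (\<Sum>a\<in>V - {x}. \<Sum>b\<in>V - {x}. w a b) + 2 * (\<Sum>b\<in>V - {x}. w x b)"
proof -
  have "(\<Sum>a\<in>V - {x}. w a x) = (\<Sum>b\<in>V - {x}. w x b)"
    using assms(3) by (intro sum.cong) auto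
  then show ?thesis
    using assms(4) by (simp add: sum.remove[OF assms(1,2)] sum.distrib)
qed

text \<open>With \<open>D\<close> the degree of \<open>x\<close> and \<open>U\<close> the weight
  away from \<open>x\<close>, the new total is at most \<open>D * (U + D)\<close>, and 4 times this
  is at most \<open>(U + 2 * D)\<^sup>2\<close>.\<close>

lemma total_weight_eliminate:
  fixes w :: "'v \<Rightarrow> 'v \<Rightarrow> nat"
  assumes "finite V" "x \<in> V" and sym: "\<And>a b. w a b = w b a" and "w x x = 0"
    and d: "d \<le> (\<Sum>b\<in>V - {x}. w x b)"
  shows "4 * (\<Sum>a\<in>V - {x}. \<Sum>b\<in>V - {x}. eliminate w x d a b) \<le> (\<Sum>a\<in>V. \<Sum>b\<in>V. w a b)\<^sup>2"
proof -
  let ?V = "V - {x}"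
  define D where "D = (\<Sum>b\<in>?V. w x b)"
  define U where "U = (\<Sum>a\<in>?V. \<Sum>b\<in>?V. w a b)"
  have D': "(\<Sum>a\<in>?V. w a x) = D"
    unfolding D_def using sym by (intro sum.cong) auto
  have "(\<Sum>a\<in>?V. \<Sum>b\<in>?V. eliminate w x d a b) \<le> (\<Sum>a\<in>?V. \<Sum>b\<in>?V. d * w a b + w a x * w x b)"
    by (intro sum_mono) (auto simp: eliminate_def)
  also have "\<dots> = d * U + D * D"
    by (simp add: sum.distrib U_def D_def[symmetric] D'[symmetric] sum_distrib_left
        sum_distrib_right flip: sum_product)
  also have "\<dots> \<le> D * U + D * D"
    using d by (simp add: D_def)
  finally have "4 * (\<Sum>a\<in>?V. \<Sum>b\<in>?V. eliminate w x d a b) \<le> 4 * (D * U + D * D)"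
    by simp
  also have "\<dots> \<le> (U + 2 * D)\<^sup>2"
    by (simp add: power2_eq_square algebra_simps)
  also have "U + 2 * D = (\<Sum>a\<in>V. \<Sum>b\<in>V. w a b)"
    using total_weight_remove[of V x w, OF assms(1-4)] by (simp add: U_def D_def)
  finally show ?thesis .
qed

section \<open>The bound for weights, by induction on the number of vertices\<close>

lemma le_two_power_exponent: "m + 2 \<le> (2::nat) ^ (3 * 2 ^ m - 2)"
proof (induction m)
  case (Suc m)
  have "(3::nat) * 2 ^ Suc m - 2 = Suc (3 * 2 ^ m - 2) + (3 * 2 ^ m - 1)"
    using one_le_power[of "2::nat" m] unfolding power_Suc by arith
  then have "(2::nat) ^ Suc (3 * 2 ^ m - 2) \<le> 2 ^ (3 * 2 ^ Suc m - 2)"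
    by (intro power_increasing) auto
  with Suc show ?case by simp
qed simp

text \<open>Half the double sum is the number of edges, since each edge is counted from both ends.
  Multiplicities enter only as quotients of the divisibility. Bounding every entry, not just the
  largest, lets the induction hypothesis apply to each summand of the relation at
  \<open>x\<close>.\<close>

lemma structure_bound:
  fixes w :: "'v \<Rightarrow> 'v \<Rightarrow> nat" and r :: "'v \<Rightarrow> nat"
  assumes "finite V" "card V = m + 2"
    and "\<And>a b. w a b = w b a" "\<And>a. w a a = 0" "connected_weights V w"
    and "\<And>a. a \<in> V \<Longrightarrow> r a > 0" "Gcd (r ` V) = 1"
    and "\<And>a. a \<in> V \<Longrightarrow> r a dvd (\<Sum>b\<in>V. r b * w a b)"
    and "a \<in> V"
  shows "fact (m + 1) * real (r a) \<le> (real (\<Sum>a\<in>V. \<Sum>b\<in>V. w a b) / 2) ^ (3 * 2 ^ m - 2)"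
  using assms
proof (induction m arbitrary: V w r a)
  case 0
  note sym = 0(3) and diag = 0(4)
  obtain b where V: "V = {a, b}" "a \<noteq> b"
  proof -
    obtain p q where "V = {p, q}" "p \<noteq> q"
      using 0(2) by (metis add_0 card_2_iff)
    then show thesis using that \<open>a \<in> V\<close> by (metis insertE insert_commute singletonD)
  qed
  \<comment> \<open>On two vertices the gcd condition is coprimality, so \<open>r a\<close> divides
    the single weight; the exponent is 1.\<close>
  have "r a dvd r b * w a b"
    using 0(8)[OF \<open>a \<in> V\<close>] V diag by simp
  moreover have "coprime (r a) (r b)"
    using 0(7) V by (simp add: coprime_iff_gcd_eq_1)
  ultimately have "r a dvd w a b"
    by (simp add: coprime_dvd_mult_right_iff)
  moreover have "w a b > 0"
  proof -
    have "\<exists>x\<in>{a}. \<exists>y\<in>V - {a}. w x y > 0"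
      using 0(5) V unfolding connected_weights_def by blast
    then show ?thesis using V by auto
  qed
  ultimately have "r a \<le> w a b" by (simp add: dvd_imp_le)
  then show ?case using V diag sym[of b a] by simp
next
  case (Suc m)
  note fin = Suc.prems(1) and sym = Suc.prems(3) and diag = Suc.prems(4)
    and conn = Suc.prems(5) and pos = Suc.prems(6) and dvd = Suc.prems(8)
  define e :: nat where "e = 3 * 2 ^ m - 2"
  define E where "E = real (\<Sum>a\<in>V. \<Sum>b\<in>V. w a b) / 2"
  have "Max (r ` V) \<in> r ` V"
    using fin \<open>a \<in> V\<close> by (intro Max_in) auto
  then obtain x where x: "x \<in> V" and "r x = Max (r ` V)" by auto
  then have max: "r y \<le> r x" if "y \<in> V" for y
    using fin that by simp
  define V' where "V' = V - {x}"
  have V': "finite V'" "card V' = m + 2"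
    using fin x Suc.prems(2) by (simp_all add: V'_def)
  then have "V' \<noteq> {}" by auto
  obtain d where d: "r x * d = (\<Sum>b\<in>V. r b * w x b)"
    using dvd[OF x] by (metis dvdE)
  have d': "r x * d = (\<Sum>b\<in>V'. r b * w x b)"
    using d diag by (simp add: V'_def sum.remove[OF fin x])
  define D where "D = (\<Sum>b\<in>V'. w x b)"
  \<comment> \<open>The cut around \<open>x\<close> yields a neighbour, hence \<open>d > 0\<close>
    and \<open>D \<ge> 1\<close>.\<close>
  have "\<exists>a\<in>{x}. \<exists>b\<in>V - {x}. w a b > 0"
    using conn x \<open>V' \<noteq> {}\<close> unfolding connected_weights_def V'_def by blast
  then obtain y where y: "y \<in> V'" "w x y > 0" by (auto simp: V'_def)
  have "0 < r y * w x y" using y pos by (simp add: V'_def)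
  also have "\<dots> \<le> r x * d"
    unfolding d' using y V' by (intro member_le_sum) auto
  finally have "d > 0" by simp
  have "w x y \<le> D"
    unfolding D_def using y V' by (intro member_le_sum) auto
  with y have "D \<ge> 1" by simp
  have "r x * d \<le> (\<Sum>b\<in>V'. r x * w x b)"
    unfolding d' by (intro sum_mono mult_right_mono max) (auto simp: V'_def)
  then have "d \<le> D"
    using pos[OF x] by (simp add: D_def flip: sum_distrib_left)

  define g where "g = Gcd (r ` V')"
  define s where "s = (\<lambda>b. r b div g)"
  have rs: "r b = g * s b" if "b \<in> V'" for b
    using that by (simp add: s_def g_def)
  have "g > 0"
    using rs[OF y(1)] pos[of y] y by (auto simp: V'_def intro: gr0I)
  have "r ` V' = (*) g ` s ` V'"
    using rs by (force simp: image_image)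
  then have "g = g * Gcd (s ` V')"
    by (metis g_def Gcd_mult normalize_nat_def id_apply)
  then have gcd: "Gcd (s ` V') = 1" using \<open>g > 0\<close> by simp
  have "V = insert x V'" using x by (auto simp: V'_def)
  then have "coprime g (r x)"
    using Suc.prems(7) by (simp add: g_def coprime_iff_gcd_eq_1 gcd.commute)
  moreover have "g dvd r x * d"
    unfolding d' g_def by (intro dvd_sum dvd_mult2 Gcd_dvd) auto
  ultimately have "g \<le> d"
    using \<open>d > 0\<close> by (simp add: coprime_dvd_mult_right_iff dvd_imp_le)

  define T' where "T' = (\<Sum>a\<in>V'. \<Sum>b\<in>V'. eliminate w x d a b)"
  have T': "real T' / 2 \<le> E\<^sup>2 / 2"
  proof -
    have "4 * T' \<le> (\<Sum>a\<in>V. \<Sum>b\<in>V. w a b)\<^sup>2"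
      unfolding T'_def V'_def
      using \<open>d \<le> D\<close> by (intro total_weight_eliminate fin x sym diag) (simp add: D_def V'_def)
    then have "real (4 * T') \<le> real ((\<Sum>a\<in>V. \<Sum>b\<in>V. w a b)\<^sup>2)"
      by (rule of_nat_mono)
    also have "\<dots> = 4 * E\<^sup>2" by (simp add: E_def power_divide)
    finally show ?thesis by simp
  qed
  have "real D \<le> E"
  proof -
    have "2 * D \<le> (\<Sum>a\<in>V. \<Sum>b\<in>V. w a b)"
      using total_weight_remove[of V x w, OF fin x sym diag] by (simp add: D_def V'_def)
    from of_nat_mono[OF this, where 'a = real] show ?thesis by (simp add: E_def)
  qed
  with \<open>D \<ge> 1\<close> have "E \<ge> 1" by simp
  have IH: "fact (m + 1) * real (s b) \<le> (real T' / 2) ^ e" if "b \<in> V'" for b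
    unfolding T'_def e_def
  proof (rule Suc.IH[OF V' _ _ _ _ gcd _ that])
    show "eliminate w x d a b = eliminate w x d b a" for a b
      using sym[of a b] sym[of a x] sym[of b x] by (simp add: eliminate_def)
    show "eliminate w x d a a = 0" for a
      by (simp add: eliminate_def)
    show "connected_weights V' (eliminate w x d)"
      unfolding V'_def by (intro connected_weights_eliminate conn x \<open>d > 0\<close> sym)
    show "s a > 0" if "a \<in> V'" for a
      using rs[OF that] pos[of a] that by (auto simp: V'_def intro: gr0I)
    show "s a dvd (\<Sum>b\<in>V'. s b * eliminate w x d a b)" if "a \<in> V'" for a
    proof -
      have "r a dvd (\<Sum>b\<in>V'. r b * eliminate w x d a b)"
        using that dvd[of a] unfolding V'_def
        by (intro dvd_sum_eliminate fin x diag d) auto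
      also have "\<dots> = g * (\<Sum>b\<in>V'. s b * eliminate w x d a b)"
        using rs by (simp add: sum_distrib_left mult.assoc)
      finally show ?thesis using rs[OF that] \<open>g > 0\<close> by simp
    qed
  qed
  have "fact (m + 1) * real (r x) \<le> real D * (real T' / 2) ^ e"
  proof -
    \<comment> \<open>Multiplying by \<open>g\<close> first is what makes the bound on
      \<open>s\<close> usable: \<open>g * r x \<le> d * r x\<close>, the relation at
      \<open>x\<close> writes the right side as \<open>g\<close> times a combination of values of
      \<open>s\<close>, and \<open>g\<close> cancels.\<close>
    have "real g * (fact (m + 1) * real (r x)) \<le> real d * (fact (m + 1) * real (r x))"
      using \<open>g \<le> d\<close> by (intro mult_right_mono) auto
    also have "\<dots> = fact (m + 1) * real (r x * d)" by simp
    also have "\<dots> = (\<Sum>b\<in>V'. real g * (real (w x b) * (fact (m + 1) * real (s b))))"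
      unfolding d' using rs by (simp add: sum_distrib_left mult_ac del: fact_Suc)
    also have "\<dots> \<le> (\<Sum>b\<in>V'. real g * (real (w x b) * (real T' / 2) ^ e))"
      by (intro sum_mono mult_left_mono IH) auto
    also have "\<dots> = real g * (real D * (real T' / 2) ^ e)"
      by (simp add: D_def sum_distrib_left sum_distrib_right)
    finally show ?thesis using \<open>g > 0\<close> by simp
  qed
  also have "\<dots> \<le> E * (E\<^sup>2 / 2) ^ e"
    using \<open>real D \<le> E\<close> \<open>E \<ge> 1\<close> T' by (intro mult_mono power_mono) auto
  finally have *: "fact (m + 1) * real (r x) \<le> E * (E\<^sup>2 / 2) ^ e" .
  \<comment> \<open>The factorial grows by the factor \<open>m + 2\<close>; the \<open>2 ^ e\<close>
    in the denominator of \<open>(E\<^sup>2 / 2) ^ e\<close> absorbs it.\<close>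
  have m: "real (m + 2) \<le> 2 ^ e"
    using of_nat_mono[OF le_two_power_exponent[of m], where 'a = real]
    unfolding e_def by (simp only: of_nat_power of_nat_numeral)
  have "fact (Suc m + 1) * real (r a) \<le> fact (Suc m + 1) * real (r x)"
    using max[OF \<open>a \<in> V\<close>] by (intro mult_left_mono) auto
  also have "\<dots> = real (m + 2) * (fact (m + 1) * real (r x))"
    by (simp add: algebra_simps)
  also have "\<dots> \<le> 2 ^ e * (E * (E\<^sup>2 / 2) ^ e)"
    by (rule mult_mono[OF m *]) auto
  also have "\<dots> = E ^ (2 * e + 1)"
    by (simp add: power_divide power_mult)
  \<comment> \<open>The target exponent is \<open>2 * e + 2\<close>, one more than needed;
    \<open>E \<ge> 1\<close> covers the gap.\<close>
  also have "\<dots> \<le> E ^ (3 * 2 ^ Suc m - 2)"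
  proof (rule power_increasing)
    show "2 * e + 1 \<le> 3 * 2 ^ Suc m - 2"
      using one_le_power[of "2::nat" m] unfolding e_def power_Suc by arith
  qed (rule \<open>E \<ge> 1\<close>)
  finally show ?case by (simp add: E_def)
qed

section \<open>From multigraphs to weights\<close>

lemma edge_mult_commute: "edge_mult G x y = edge_mult G y x"
  by (simp add: edge_mult_def insert_commute)

lemma edge_mult_self: "loopless_multigraph G \<Longrightarrow> edge_mult G x x = 0"
  by (auto simp: edge_mult_def loopless_multigraph_def)

text \<open>Double counting: each edge is met by exactly two ordered pairs, as its ends are
  distinct.\<close>

lemma sum_edge_mult:
  assumes "loopless_multigraph G"
  shows "(\<Sum>x\<in>verts G. \<Sum>y\<in>verts G. edge_mult G x y) = 2 * card (edges G)"
proof -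
  let ?V = "verts G" and ?E = "edges G"
  have fin: "finite ?V" "finite ?E"
    and ends: "\<And>e. e \<in> ?E \<Longrightarrow> ends G e \<subseteq> ?V \<and> card (ends G e) = 2"
    using assms by (auto simp: loopless_multigraph_def)
  have "(\<Sum>x\<in>?V. \<Sum>y\<in>?V. edge_mult G x y)
      = (\<Sum>p\<in>?V \<times> ?V. card {e \<in> ?E. ends G e = {fst p, snd p}})"
    by (simp add: sum.cartesian_product edge_mult_def case_prod_beta)
  also have "\<dots> = 2 * card ?E"
  proof (rule sum_multicount)
    show "\<forall>e\<in>?E. card {p \<in> ?V \<times> ?V. ends G e = {fst p, snd p}} = 2"
    proof
      fix e assume "e \<in> ?E"
      then obtain a b where ab: "ends G e = {a, b}" "a \<noteq> b" "a \<in> ?V" "b \<in> ?V"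
        using ends[of e] by (auto simp: card_2_iff)
      then have "{p \<in> ?V \<times> ?V. ends G e = {fst p, snd p}} = {(a, b), (b, a)}"
        unfolding ab(1) doubleton_eq_iff by auto
      then show "card {p \<in> ?V \<times> ?V. ends G e = {fst p, snd p}} = 2"
        using ab by simp
    qed
  qed (use fin in auto)
  finally show ?thesis .
qed

lemma connected_weights_edge_mult:
  assumes "loopless_multigraph G" "connected_multigraph G"
  shows "connected_weights (verts G) (edge_mult G)"
  unfolding connected_weights_def
proof (intro allI impI)
  fix S assume S: "S \<subseteq> verts G" "S \<noteq> {}" "S \<noteq> verts G"
  then obtain x y where x: "x \<in> S" and y: "y \<in> verts G" "y \<notin> S" by blast
  have "(x, y) \<in> (adjacency G)\<^sup>*"
    using assms(2) S x y by (auto simp: connected_multigraph_def)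
  \<comment> \<open>A path that starts in \<open>S\<close> either stays there or has a step leaving
    \<open>S\<close>.\<close>
  then have "y \<in> S \<or> (\<exists>a\<in>S. \<exists>b. b \<notin> S \<and> (a, b) \<in> adjacency G)"
    by (induction rule: rtrancl_induct) (use x in auto)
  with y obtain a b e where e: "a \<in> S" "b \<notin> S" "e \<in> edges G" "ends G e = {a, b}"
    by (auto simp: adjacency_def)
  moreover have "b \<in> verts G" "finite (edges G)"
    using assms(1) e by (auto simp: loopless_multigraph_def)
  moreover from this e have "edge_mult G a b > 0"
    by (auto simp: edge_mult_def card_gt_0_iff)
  ultimately show "\<exists>a\<in>S. \<exists>b\<in>verts G - S. edge_mult G a b > 0" by blast
qed

theorem theorem3p4:
  fixes G :: "('v, 'e) multigraph" and n :: nat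
    and r d :: "'v \<Rightarrow> nat" and v :: "nat \<Rightarrow> 'v"
  assumes "loopless_multigraph G"
    and "connected_multigraph G"
    and "n \<ge> 2"
    and "bij_betw v {1..n} (verts G)"
    and "arithmetical_structure G r d"
    and "\<And>i j. 1 \<le> i \<Longrightarrow> i \<le> j \<Longrightarrow> j \<le> n \<Longrightarrow> r (v j) \<le> r (v i)"
  shows "real (r (v 1)) \<le> 1 / fact (n - 1) * real (card (edges G)) ^ (3 * 2 ^ (n - 2) - 2)"
proof -
  have fin: "finite (verts G)" using assms(1) by (simp add: loopless_multigraph_def)
  have "fact (n - 2 + 1) * real (r (v 1)) \<le>
    (real (\<Sum>x\<in>verts G. \<Sum>y\<in>verts G. edge_mult G x y) / 2) ^ (3 * 2 ^ (n - 2) - 2)"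
  proof (rule structure_bound[OF fin _ edge_mult_commute edge_mult_self[OF assms(1)]
        connected_weights_edge_mult[OF assms(1,2)]])
    show "card (verts G) = n - 2 + 2"
      using bij_betw_same_card[OF assms(4)] \<open>n \<ge> 2\<close> by simp
    show "v 1 \<in> verts G"
      using bij_betwE[OF assms(4)] \<open>n \<ge> 2\<close> by simp
    show "r x > 0" if "x \<in> verts G" for x
      using assms(5) that by (simp add: arithmetical_structure_def)
    show "Gcd (r ` verts G) = 1"
      using assms(5) by (simp add: arithmetical_structure_def)
    show "r x dvd (\<Sum>y\<in>verts G. r y * edge_mult G x y)" if "x \<in> verts G" for x
    proof -
      \<comment> \<open>Including the term at \<open>x\<close> itself changes nothing, as there are
        no loops.\<close>
      have "(\<Sum>y\<in>verts G. r y * edge_mult G x y) = r x * d x"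
        using assms(5) that edge_mult_self[OF assms(1), of x]
        by (simp add: arithmetical_structure_def sum.remove[OF fin that])
      then show ?thesis by simp
    qed
  qed
  moreover have "n - 2 + 1 = n - 1" using \<open>n \<ge> 2\<close> by simp
  ultimately show ?thesis
    by (simp add: sum_edge_mult[OF assms(1)] field_simps del: fact_Suc)
qed

end
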